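(* There is a hereditary class of finite graphs of unbounded clique-width that does not contain (as a subclass) any minimal hereditary class of unbounded clique-width.
   Context: A class of graphs is hereditary if it is closed under taking induced subgraphs. It has unbounded clique-width if there is no uniform bound on the clique-width of its members. A hereditary class of unbounded clique-width is minimal if no proper hereditary subclass of it has unbounded clique-width. *)

theory Defs
  imports "Graph_Theory.Pair_Digraph" "Graph_Theory.Digraph_Isomorphism"
begin

text \<open>
  A finite simple graph is a \<^const>\<open>pair_graph\<close>: its arc set is a finite, symmetric and
  irreflexive relation on a finite vertex set, the edge \<open>uv\<close> being the two arcs
  \<open>(u, v)\<close> and \<open>(v, u)\<close>. The graph without vertices is allowed.
\<close>

datatype (cw_verts: 'a, cw_labels: 'l) cw_expr =
  Vertex 'l 'a
| Union "('a, 'l) cw_expr" "('a, 'l) cw_expr"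
| Join 'l 'l "('a, 'l) cw_expr"
| Relabel 'l 'l "('a, 'l) cw_expr"

text \<open>Only the values on the vertices of the expression are meaningful.\<close>

primrec cw_lab :: "('a, 'l) cw_expr \<Rightarrow> 'a \<Rightarrow> 'l" where
  "cw_lab (Vertex i v) = (\<lambda>_. i)"
| "cw_lab (Union s t) = (\<lambda>v. if v \<in> cw_verts s then cw_lab s v else cw_lab t v)"
| "cw_lab (Join i j t) = cw_lab t"
| "cw_lab (Relabel i j t) = (\<lambda>v. if cw_lab t v = i then j else cw_lab t v)"

primrec cw_arcs :: "('a, 'l) cw_expr \<Rightarrow> 'a rel" where
  "cw_arcs (Vertex i v) = {}"
| "cw_arcs (Union s t) = cw_arcs s \<union> cw_arcs t"
| "cw_arcs (Join i j t) = cw_arcs t \<union>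
     {(u, v). u \<in> cw_verts t \<and> v \<in> cw_verts t \<and>
        (cw_lab t u = i \<and> cw_lab t v = j \<or> cw_lab t u = j \<and> cw_lab t v = i)}"
| "cw_arcs (Relabel i j t) = cw_arcs t"

text \<open>Unions are disjoint, and joins are between two distinct labels.\<close>

primrec cw_wf :: "('a, 'l) cw_expr \<Rightarrow> bool" where
  "cw_wf (Vertex i v) \<longleftrightarrow> True"
| "cw_wf (Union s t) \<longleftrightarrow> cw_wf s \<and> cw_wf t \<and> cw_verts s \<inter> cw_verts t = {}"
| "cw_wf (Join i j t) \<longleftrightarrow> cw_wf t \<and> i \<noteq> j"
| "cw_wf (Relabel i j t) \<longleftrightarrow> cw_wf t"

definition cw_graph :: "('a, 'l) cw_expr \<Rightarrow> 'a pair_pre_digraph" where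
  "cw_graph t = \<lparr>pverts = cw_verts t, parcs = cw_arcs t\<rparr>"

text \<open>
  The graph without vertices is not the value of any expression; its clique-width is
  \<open>0\<close> by convention.
\<close>

definition clique_width :: "'a pair_pre_digraph \<Rightarrow> nat" where
  "clique_width G =
     (if pverts G = {} then 0
      else LEAST k. \<exists>t :: ('a, nat) cw_expr. cw_wf t \<and> cw_graph t = G \<and> card (cw_labels t) = k)"

text \<open>
  Every finite graph has an isomorphic copy with vertices in \<^typ>\<open>nat\<close>, so a class of
  finite graphs is an isomorphism-closed set of finite graphs on natural numbers.
\<close>

definition graph_class :: "nat pair_pre_digraph set \<Rightarrow> bool" where
  "graph_class X \<longleftrightarrow>
     (\<forall>G \<in> X. pair_graph G) \<and>
     (\<forall>G \<in> X. \<forall>H. digraph_iso (with_proj G) (with_proj H) \<longrightarrow> H \<in> X)"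

definition hereditary :: "nat pair_pre_digraph set \<Rightarrow> bool" where
  "hereditary X \<longleftrightarrow>
     graph_class X \<and>
     (\<forall>G \<in> X. \<forall>H. induced_subgraph (with_proj H) (with_proj G) \<longrightarrow> H \<in> X)"

definition unbounded_clique_width :: "nat pair_pre_digraph set \<Rightarrow> bool" where
  "unbounded_clique_width X \<longleftrightarrow> \<not> (\<exists>k. \<forall>G \<in> X. clique_width G \<le> k)"

definition minimal_unbounded_clique_width :: "nat pair_pre_digraph set \<Rightarrow> bool" where
  "minimal_unbounded_clique_width X \<longleftrightarrow>
     hereditary X \<and> unbounded_clique_width X \<and>
     \<not> (\<exists>Y. Y \<subset> X \<and> hereditary Y \<and> unbounded_clique_width Y)"

end

theory Submission
  imports Defs "HOL-Library.Nat_Bijection"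
begin

text \<open>
  Let \<open>W\<^sub>n\<close> be the \<open>n\<close> by \<open>n\<close> grid with every edge subdivided into a path of length \<open>n\<close>, and let
  \<open>X\<close> be the class of induced subgraphs of the \<open>W\<^sub>n\<close>. Every subexpression of a clique-width
  expression gives a cut with few distinct neighbourhoods across it; choosing one that balances the
  branch vertices, many rows or many columns of \<open>W\<^sub>n\<close> cross the cut, so the clique-width of \<open>W\<^sub>n\<close>
  tends to infinity. A graph with fewer than \<open>n - 1\<close> vertices embedded in \<open>W\<^sub>n\<close> is a forest and
  has clique-width at most 3.

  If \<open>Y \<subseteq> X\<close> is hereditary of unbounded clique-width, take \<open>H \<in> Y\<close> of clique-width greater than
  3. Then \<open>H\<close> embeds only in finitely many \<open>W\<^sub>n\<close>, so the members of \<open>Y\<close> that avoid \<open>H\<close> still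
  have unbounded clique-width, and \<open>Y\<close> is not minimal.
\<close>

section \<open>Expressions and the value of clique-width\<close>

lemma finite_cw_labels: "finite (cw_labels t)"
  by (induction t) auto

lemma cw_lab_in_labels: "v \<in> cw_verts t \<Longrightarrow> cw_lab t v \<in> cw_labels t"
  by (induction t) auto

lemma cw_arcs_subset: "cw_arcs t \<subseteq> cw_verts t \<times> cw_verts t"
  by (induction t) auto

lemma clique_width_le:
  fixes t :: "('a, nat) cw_expr"
  assumes "cw_wf t" "cw_graph t = G"
  shows "clique_width G \<le> card (cw_labels t)"
  using assms unfolding clique_width_def by (auto intro!: Least_le)

lemma edgeless_expr:
  assumes "finite V" "V \<noteq> {}"
  shows "\<exists>t :: ('a, 'l) cw_expr. cw_wf t \<and> cw_verts t = V \<and> cw_arcs t = {} \<and>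
           cw_labels t \<subseteq> f ` V \<and> (\<forall>v \<in> V. cw_lab t v = f v)"
  using assms
proof (induction V rule: finite_ne_induct)
  case (singleton x)
  show ?case by (rule exI[of _ "Vertex (f x) x"]) auto
next
  case (insert x V)
  then obtain t :: "('a, 'l) cw_expr" where
    "cw_wf t" "cw_verts t = V" "cw_arcs t = {}" "cw_labels t \<subseteq> f ` V" "\<forall>v \<in> V. cw_lab t v = f v"
    by blast
  with insert.hyps show ?case by (intro exI[of _ "Union (Vertex (f x) x) t"]) auto
qed

text \<open>Under an injective labelling, a join on the labels of two vertices adds just the edge
  between them, so edges can be inserted one at a time.\<close>

lemma distinct_labels_expr:
  assumes "finite V" "V \<noteq> {}" "inj_on f V"
    and "finite F" "F \<subseteq> V \<times> V" "irrefl F"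
  shows "\<exists>t :: ('a, 'l) cw_expr. cw_wf t \<and> cw_verts t = V \<and> cw_arcs t = F \<union> F\<inverse> \<and>
           cw_labels t \<subseteq> f ` V \<and> (\<forall>v \<in> V. cw_lab t v = f v)"
  using assms(4-6)
proof (induction F rule: finite_induct)
  case empty
  show ?case using edgeless_expr[OF assms(1,2), of f] by simp
next
  case (insert e F)
  obtain u v where e: "e = (u, v)" by (cases e)
  have uv: "u \<in> V" "v \<in> V" "u \<noteq> v" using insert.prems e by (auto simp: irrefl_def)
  then have fuv: "f u \<noteq> f v" using assms(3) by (auto dest: inj_onD)
  have "irrefl F" using insert.prems by (auto simp: irrefl_def)
  with insert obtain t :: "('a, 'l) cw_expr" where t:
    "cw_wf t" "cw_verts t = V" "cw_arcs t = F \<union> F\<inverse>" "cw_labels t \<subseteq> f ` V"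
    "\<forall>v \<in> V. cw_lab t v = f v"
    by auto
  have "{(a, b). a \<in> V \<and> b \<in> V \<and> (cw_lab t a = f u \<and> cw_lab t b = f v \<or>
           cw_lab t a = f v \<and> cw_lab t b = f u)} = {(u, v), (v, u)}"
    using t(5) uv assms(3) by (auto dest: inj_onD)
  then have "cw_arcs (Join (f u) (f v) t) = insert e F \<union> (insert e F)\<inverse>"
    using t(2,3) e by auto
  with t uv fuv show ?case by (intro exI[of _ "Join (f u) (f v) t"]) auto
qed

lemma pair_graph_iff:
  "pair_graph G \<longleftrightarrow> finite (pverts G) \<and> parcs G \<subseteq> pverts G \<times> pverts G \<and>
     sym (parcs G) \<and> irrefl (parcs G)"
proof
  assume "pair_graph G"
  then interpret pair_graph G .
  show "finite (pverts G) \<and> parcs G \<subseteq> pverts G \<times> pverts G \<and> sym (parcs G) \<and> irrefl (parcs G)"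
    using pair_finite_verts arc_fst_in_verts arc_snd_in_verts pair_sym_arcs pair_no_loops
    by (fastforce simp: symmetric_def irrefl_def)
next
  assume a: "finite (pverts G) \<and> parcs G \<subseteq> pverts G \<times> pverts G \<and> sym (parcs G) \<and> irrefl (parcs G)"
  then have "finite (parcs G)" by (meson finite_SigmaI finite_subset)
  with a show "pair_graph G"
    by unfold_locales (auto simp: symmetric_def irrefl_def)
qed

text \<open>With every vertex as its own label, any nonempty graph has an expression. Hence the
  \<open>LEAST\<close> in \<open>clique_width\<close> is attained and is at most the number of
  vertices.\<close>

lemma pair_graph_expr:
  fixes G :: "nat pair_pre_digraph"
  assumes "pair_graph G" "pverts G \<noteq> {}"
  shows "\<exists>t :: (nat, nat) cw_expr. cw_wf t \<and> cw_graph t = G \<and> cw_labels t \<subseteq> pverts G"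
proof -
  have g: "finite (pverts G)" "parcs G \<subseteq> pverts G \<times> pverts G" "sym (parcs G)" "irrefl (parcs G)"
    using assms(1) by (auto simp: pair_graph_iff)
  moreover have "finite (parcs G)" using g(1,2) by (meson finite_SigmaI finite_subset)
  ultimately obtain t :: "(nat, nat) cw_expr" where
    "cw_wf t" "cw_verts t = pverts G" "cw_arcs t = parcs G \<union> (parcs G)\<inverse>" "cw_labels t \<subseteq> id ` pverts G"
    using distinct_labels_expr[of "pverts G" id "parcs G"] assms(2) by auto
  moreover have "(parcs G)\<inverse> = parcs G" using g(3) by (simp add: sym_conv_converse_eq)
  ultimately show ?thesis by (intro exI[of _ t]) (simp add: cw_graph_def)
qed

lemma clique_width_le_card:
  fixes G :: "nat pair_pre_digraph"
  assumes "pair_graph G"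
  shows "clique_width G \<le> card (pverts G)"
proof (cases "pverts G = {}")
  case True
  then show ?thesis by (simp add: clique_width_def)
next
  case False
  then obtain t :: "(nat, nat) cw_expr" where "cw_wf t" "cw_graph t = G" "cw_labels t \<subseteq> pverts G"
    using pair_graph_expr[OF assms] by blast
  moreover have "finite (pverts G)" using assms by (simp add: pair_graph_iff)
  ultimately show ?thesis by (meson card_mono clique_width_le le_trans)
qed

lemma clique_width_attained:
  fixes G :: "nat pair_pre_digraph"
  assumes "pair_graph G" "pverts G \<noteq> {}"
  obtains t :: "(nat, nat) cw_expr"
  where "cw_wf t" "cw_graph t = G" "card (cw_labels t) = clique_width G"
proof -
  have "\<exists>k. \<exists>t :: (nat, nat) cw_expr. cw_wf t \<and> cw_graph t = G \<and> card (cw_labels t) = k"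
    using pair_graph_expr[OF assms] by blast
  from LeastI_ex[OF this] show ?thesis
    using that assms(2) by (auto simp: clique_width_def)
qed

section \<open>Forests\<close>

text \<open>
  A vertex with no neighbour of smaller depth is a root. Label 1 is reserved for the roots:
  deleting the root of a tree turns exactly its neighbours into roots, so one join reattaches it.
\<close>

lemma forest_expr:
  fixes d :: "'a \<Rightarrow> nat"
  assumes "finite V" "V \<noteq> {}" "E \<subseteq> V \<times> V" "sym E"
    and "\<And>u v. (u, v) \<in> E \<Longrightarrow> d u \<noteq> d v"
    and "\<And>u v w. (u, v) \<in> E \<Longrightarrow> (u, w) \<in> E \<Longrightarrow> d v < d u \<Longrightarrow> d w < d u \<Longrightarrow> v = w"
  shows "\<exists>t :: ('a, nat) cw_expr. cw_wf t \<and> cw_verts t = V \<and> cw_arcs t = E \<and>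
           cw_labels t \<subseteq> {0, 1, 2} \<and>
           (\<forall>v \<in> V. cw_lab t v = (if \<exists>u. (v, u) \<in> E \<and> d u < d v then 0 else 1))"
  using assms
proof (induction V arbitrary: E rule: finite_psubset_induct)
  case (psubset V)
  note E = psubset.prems
  have IH: "\<exists>t :: ('a, nat) cw_expr. cw_wf t \<and> cw_verts t = U \<and> cw_arcs t = E \<inter> U \<times> U \<and>
      cw_labels t \<subseteq> {0, 1, 2} \<and>
      (\<forall>v \<in> U. cw_lab t v = (if \<exists>u. (v, u) \<in> E \<inter> U \<times> U \<and> d u < d v then 0 else 1))"
    if "U \<subset> V" "U \<noteq> {}" for U
  proof (rule psubset.IH)
    show "sym (E \<inter> U \<times> U)" using E(3) by (auto simp: sym_def)
    show "v = w" if "(u, v) \<in> E \<inter> U \<times> U" "(u, w) \<in> E \<inter> U \<times> U" "d v < d u" "d w < d u" for u v w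
      using that E(5)[of u v w] by blast
  qed (use that E(4) in auto)
  obtain r where r: "r \<in> V" "\<And>v. v \<in> V \<Longrightarrow> d r \<le> d v"
    using arg_min_if_finite[OF psubset.hyps(1) E(1), of d] by (metis not_le)
  \<comment> \<open>The parent relation: by the hypotheses on \<open>d\<close>, every edge joins a
    vertex to its unique neighbour of smaller depth.\<close>
  define P where "P = {(v, u). (v, u) \<in> E \<and> d u < d v}"
  have P_fun: "(v, u) \<in> P \<Longrightarrow> (v, w) \<in> P \<Longrightarrow> u = w" for u v w
    using E(5)[of v u w] by (simp add: P_def)
  have r_root: "(r, u) \<notin> P" for u
    using r(2)[of u] E(2) by (auto simp: P_def)
  have E_P: "(u, v) \<in> E \<longleftrightarrow> (u, v) \<in> P \<or> (v, u) \<in> P" for u v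
    using E(3) E(4)[of u v] by (auto simp: P_def dest: symD)
  \<comment> \<open>The tree of \<open>r\<close>: the vertices whose chain of parents reaches
    \<open>r\<close>.\<close>
  define D where "D = {v \<in> V. (v, r) \<in> P\<^sup>*}"
  have rD: "r \<in> D" using r(1) by (simp add: D_def)
  show ?case
  proof (cases "D = V")
    case False
    then have D: "D \<subset> V" by (auto simp: D_def)
    \<comment> \<open>The root \<open>r\<close> has no parent, so \<open>u\<close> differs from
      \<open>r\<close> and its chain to \<open>r\<close> passes through its only parent
      \<open>v\<close>. Hence no edge leaves \<open>D\<close>, and a disjoint union of the two sides
      suffices.\<close>
    have up: "u \<in> D \<longleftrightarrow> v \<in> D" if "(u, v) \<in> P" for u v
    proof
      have "u \<in> V" "v \<in> V" using that E(2) by (auto simp: P_def)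
      then show "v \<in> D \<Longrightarrow> u \<in> D" using that by (auto simp: D_def)
      assume "u \<in> D"
      then have "(u, r) \<in> P\<^sup>*" by (simp add: D_def)
      then show "v \<in> D"
      proof (cases rule: converse_rtranclE)
        case base
        with that r_root show ?thesis by auto
      next
        case (step w)
        with P_fun[OF that step(1)] \<open>v \<in> V\<close> show ?thesis by (simp add: D_def)
      qed
    qed
    have closed: "u \<in> D \<longleftrightarrow> v \<in> D" if "(u, v) \<in> E" for u v
      using that up E_P by blast
    have "D \<noteq> {}" using rD by blast
    from IH[OF D this] obtain s :: "('a, nat) cw_expr" where
      s: "cw_wf s" "cw_verts s = D" "cw_arcs s = E \<inter> D \<times> D" "cw_labels s \<subseteq> {0, 1, 2}"
        "\<forall>v \<in> D. cw_lab s v = (if \<exists>u. (v, u) \<in> E \<inter> D \<times> D \<and> d u < d v then 0 else 1)"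
      by (elim exE conjE)
    have "V - D \<subset> V" "V - D \<noteq> {}" using D rD by blast+
    from IH[OF this] obtain t :: "('a, nat) cw_expr" where
      t: "cw_wf t" "cw_verts t = V - D" "cw_arcs t = E \<inter> (V - D) \<times> (V - D)" "cw_labels t \<subseteq> {0, 1, 2}"
        "\<forall>v \<in> V - D. cw_lab t v = (if \<exists>u. (v, u) \<in> E \<inter> (V - D) \<times> (V - D) \<and> d u < d v then 0 else 1)"
      by (elim exE conjE)
    have arcs: "E \<inter> D \<times> D \<union> E \<inter> (V - D) \<times> (V - D) = E"
      using closed E(2) by blast
    have root1: "(\<exists>u. (v, u) \<in> E \<inter> D \<times> D \<and> d u < d v) \<longleftrightarrow> (\<exists>u. (v, u) \<in> E \<and> d u < d v)"
      if "v \<in> D" for v using closed that by blast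
    have root2: "(\<exists>u. (v, u) \<in> E \<inter> (V - D) \<times> (V - D) \<and> d u < d v) \<longleftrightarrow> (\<exists>u. (v, u) \<in> E \<and> d u < d v)"
      if "v \<in> V - D" for v using closed that E(2) by blast
    show ?thesis
    proof (intro exI[of _ "Union s t"] conjI ballI)
      fix v assume "v \<in> V"
      then show "cw_lab (Union s t) v = (if \<exists>u. (v, u) \<in> E \<and> d u < d v then 0 else 1)"
        using s(2,5) t(5) root1 root2 by (cases "v \<in> D") simp_all
    qed (use s(1-4) t(1-4) D arcs in auto)
  next
    case True
    have parent: "\<exists>u. (v, u) \<in> P" if "v \<in> V" "v \<noteq> r" for v
    proof -
      have "v \<in> D" using True that(1) by blast
      then have "(v, r) \<in> P\<^sup>*" by (simp add: D_def)
      then show ?thesis by (cases rule: converse_rtranclE) (use that(2) in auto)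
    qed
    show ?thesis
    proof (cases "V = {r}")
      case V: True
      then have "E = {}" using E(2) E_P[of r r] r_root by auto
      with V show ?thesis by (intro exI[of _ "Vertex 1 r"]) auto
    next
      case False
      let ?U = "V - {r}"
      obtain t :: "('a, nat) cw_expr" where
        t: "cw_wf t" "cw_verts t = ?U" "cw_arcs t = E \<inter> ?U \<times> ?U" "cw_labels t \<subseteq> {0, 1, 2}"
          "\<forall>v \<in> ?U. cw_lab t v = (if \<exists>u. (v, u) \<in> E \<inter> ?U \<times> ?U \<and> d u < d v then 0 else 1)"
      proof -
        have "?U \<subset> V" "?U \<noteq> {}" using False r(1) by blast+
        from IH[OF this] that show ?thesis by (elim exE conjE)
      qed
      have lab: "cw_lab t v = (if (v, r) \<in> E then 1 else 0)" if "v \<in> ?U" for v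
      proof -
        \<comment> \<open>Deleting \<open>r\<close> takes away the parent of \<open>v\<close> only
          if that parent is \<open>r\<close>, so label 1 in \<open>t\<close> marks exactly the
          neighbours of \<open>r\<close>.\<close>
        obtain u where u: "(v, u) \<in> P" using parent \<open>v \<in> ?U\<close> by blast
        have "(\<exists>u. (v, u) \<in> E \<inter> ?U \<times> ?U \<and> d u < d v) \<longleftrightarrow> u \<noteq> r"
          using u that P_fun[OF u] E(2) unfolding P_def by blast
        moreover have "(v, r) \<in> E \<longleftrightarrow> u = r"
          using u P_fun[OF u] E_P r_root by blast
        ultimately show ?thesis using t(5) that by auto
      qed
      \<comment> \<open>Label 2 isolates \<open>r\<close> during the join. Then its neighbours
        become non-roots with label 0, which frees label 1 for \<open>r\<close>.\<close>
      let ?t = "Relabel 2 1 (Relabel 1 0 (Join 1 2 (Union (Vertex 2 r) t)))"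
      have lab': "cw_lab (Union (Vertex 2 r) t) v = (if v = r then 2 else if (v, r) \<in> E then 1 else 0)"
        if "v \<in> V" for v using lab[of v] that by simp
      have "cw_arcs ?t = E \<inter> ?U \<times> ?U \<union> {(u, v). u \<in> V \<and> v \<in> V \<and>
          (u \<noteq> r \<and> (u, r) \<in> E \<and> v = r \<or> u = r \<and> v \<noteq> r \<and> (v, r) \<in> E)}"
      proof -
        have "cw_verts (Union (Vertex 2 r) t) = V" using t(2) r(1) by auto
        moreover have "cw_lab (Union (Vertex 2 r) t) v = 1 \<longleftrightarrow> v \<noteq> r \<and> (v, r) \<in> E"
          "cw_lab (Union (Vertex 2 r) t) v = 2 \<longleftrightarrow> v = r" if "v \<in> V" for v
          using lab'[OF that] by (auto split: if_splits)
        moreover have "cw_arcs (Union (Vertex 2 r) t) = E \<inter> ?U \<times> ?U" using t(3) by simp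
        ultimately show ?thesis
          unfolding cw_arcs.simps(3,4) by (intro arg_cong2[where f = "(\<union>)"]) blast+
      qed
      also have "\<dots> = E"
      proof -
        have "(r, r) \<notin> E" using E(4) by blast
        moreover have "(v, r) \<in> E" if "(r, v) \<in> E" for v using E(3) that by (rule symD)
        moreover have "(r, v) \<in> E" if "(v, r) \<in> E" for v using E(3) that by (rule symD)
        ultimately show ?thesis using E(2) by blast
      qed
      finally have "cw_arcs ?t = E" .
      moreover have "cw_lab ?t v = (if \<exists>u. (v, u) \<in> E \<and> d u < d v then 0 else 1)" if "v \<in> V" for v
      proof -
        have "(\<exists>u. (v, u) \<in> E \<and> d u < d v) \<longleftrightarrow> v \<noteq> r"
          using parent[OF that] r_root by (auto simp: P_def)
        then show ?thesis using lab'[OF that] by (auto split: if_splits)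
      qed
      moreover have "cw_wf ?t" "cw_verts ?t = V" "cw_labels ?t \<subseteq> {0, 1, 2}"
        using t(1,2,4) r(1) by auto
      ultimately show ?thesis by blast
    qed
  qed
qed

section \<open>Balanced cuts of small label complexity\<close>

text \<open>
  The cuts given by subexpressions; \<open>f\<close> is the labelling at the subexpression. The
  clause on \<^const>\<open>cw_lab\<close> makes the notion stable under the outer operations.
\<close>

definition cw_cut :: "('a, 'l) cw_expr \<Rightarrow> 'a set \<Rightarrow> ('a \<Rightarrow> 'l) \<Rightarrow> bool" where
  "cw_cut t A f \<longleftrightarrow> A \<subseteq> cw_verts t \<and> f ` A \<subseteq> cw_labels t \<and>
     (\<forall>u \<in> A. \<forall>v \<in> A. f u = f v \<longrightarrow> cw_lab t u = cw_lab t v \<and>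
        (\<forall>x \<in> cw_verts t - A. (u, x) \<in> cw_arcs t \<longleftrightarrow> (v, x) \<in> cw_arcs t))"

lemma cw_cutI:
  assumes "A \<subseteq> cw_verts t" "f ` A \<subseteq> cw_labels t"
    and "\<And>u v. u \<in> A \<Longrightarrow> v \<in> A \<Longrightarrow> f u = f v \<Longrightarrow> cw_lab t u = cw_lab t v"
    and "\<And>u v x. u \<in> A \<Longrightarrow> v \<in> A \<Longrightarrow> f u = f v \<Longrightarrow> x \<in> cw_verts t \<Longrightarrow> x \<notin> A \<Longrightarrow>
           (u, x) \<in> cw_arcs t \<Longrightarrow> (v, x) \<in> cw_arcs t"
  shows "cw_cut t A f"
  unfolding cw_cut_def
proof (intro conjI ballI impI)
  fix u v x assume uv: "u \<in> A" "v \<in> A" "f u = f v" and x: "x \<in> cw_verts t - A"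
  show "(u, x) \<in> cw_arcs t \<longleftrightarrow> (v, x) \<in> cw_arcs t"
    using assms(4)[of u v x] assms(4)[of v u x] uv x by auto
qed (fact assms(1-3))+

lemma cw_cutD:
  assumes "cw_cut t A f"
  shows "A \<subseteq> cw_verts t" "f ` A \<subseteq> cw_labels t"
    and "u \<in> A \<Longrightarrow> v \<in> A \<Longrightarrow> f u = f v \<Longrightarrow> cw_lab t u = cw_lab t v"
    and "u \<in> A \<Longrightarrow> v \<in> A \<Longrightarrow> f u = f v \<Longrightarrow> x \<in> cw_verts t \<Longrightarrow> x \<notin> A \<Longrightarrow>
           (u, x) \<in> cw_arcs t \<Longrightarrow> (v, x) \<in> cw_arcs t"
  using assms unfolding cw_cut_def by blast+

text \<open>An expression has no vertices outside its own vertex set, so this cut is trivial; the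
  next lemmas carry a cut outwards through each operation.\<close>

lemma cw_cut_self: "cw_cut t (cw_verts t) (cw_lab t)"
  by (rule cw_cutI) (auto simp: cw_lab_in_labels)

lemma cw_cut_Union1:
  assumes "cw_cut s A f" "cw_verts s \<inter> cw_verts t = {}"
  shows "cw_cut (Union s t) A f"
proof (rule cw_cutI)
  note cut = cw_cutD[OF assms(1)]
  show "A \<subseteq> cw_verts (Union s t)" "f ` A \<subseteq> cw_labels (Union s t)" using cut(1,2) by auto
  fix u v assume uv: "u \<in> A" "v \<in> A" "f u = f v"
  then have "u \<in> cw_verts s" "v \<in> cw_verts s" using cut(1) by blast+
  then show "cw_lab (Union s t) u = cw_lab (Union s t) v" using cut(3)[OF uv] by simp
  fix x assume x: "x \<notin> A" "(u, x) \<in> cw_arcs (Union s t)"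
  have "u \<notin> cw_verts t" using uv(1) cut(1) assms(2) by blast
  with x(2) have "(u, x) \<in> cw_arcs s" "x \<in> cw_verts s"
    using cw_arcs_subset[of s] cw_arcs_subset[of t] by auto
  then show "(v, x) \<in> cw_arcs (Union s t)" using cut(4)[OF uv _ x(1)] by simp
qed

lemma cw_cut_Union2:
  assumes "cw_cut t A f" "cw_verts s \<inter> cw_verts t = {}"
  shows "cw_cut (Union s t) A f"
proof (rule cw_cutI)
  note cut = cw_cutD[OF assms(1)]
  show "A \<subseteq> cw_verts (Union s t)" "f ` A \<subseteq> cw_labels (Union s t)" using cut(1,2) by auto
  fix u v assume uv: "u \<in> A" "v \<in> A" "f u = f v"
  have not_s: "u \<notin> cw_verts s" "v \<notin> cw_verts s" using uv cut(1) assms(2) by blast+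
  then show "cw_lab (Union s t) u = cw_lab (Union s t) v" using cut(3)[OF uv] by simp
  fix x assume x: "x \<notin> A" "(u, x) \<in> cw_arcs (Union s t)"
  with not_s have "(u, x) \<in> cw_arcs t" "x \<in> cw_verts t"
    using cw_arcs_subset[of s] cw_arcs_subset[of t] by auto
  then show "(v, x) \<in> cw_arcs (Union s t)" using cut(4)[OF uv _ x(1)] by simp
qed

text \<open>Equal values of \<open>f\<close> force equal current labels, and a join treats vertices
  with equal labels alike.\<close>

lemma cw_cut_Join:
  assumes "cw_cut t A f"
  shows "cw_cut (Join i j t) A f"
proof (rule cw_cutI)
  note cut = cw_cutD[OF assms]
  show "A \<subseteq> cw_verts (Join i j t)" "f ` A \<subseteq> cw_labels (Join i j t)" using cut(1,2) by auto
  fix u v assume uv: "u \<in> A" "v \<in> A" "f u = f v"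
  then show "cw_lab (Join i j t) u = cw_lab (Join i j t) v" using cut(3)[OF uv] by simp
  fix x assume x: "x \<in> cw_verts (Join i j t)" "x \<notin> A" "(u, x) \<in> cw_arcs (Join i j t)"
  have "v \<in> cw_verts t" using uv(2) cut(1) by blast
  then show "(v, x) \<in> cw_arcs (Join i j t)" using cut(4)[OF uv _ x(2)] cut(3)[OF uv] x(1,3) by auto
qed

lemma cw_cut_Relabel:
  assumes "cw_cut t A f"
  shows "cw_cut (Relabel i j t) A f"
proof (rule cw_cutI)
  note cut = cw_cutD[OF assms]
  show "A \<subseteq> cw_verts (Relabel i j t)" "f ` A \<subseteq> cw_labels (Relabel i j t)" using cut(1,2) by auto
  fix u v assume uv: "u \<in> A" "v \<in> A" "f u = f v"
  then show "cw_lab (Relabel i j t) u = cw_lab (Relabel i j t) v" using cut(3)[OF uv] by simp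
  fix x assume "x \<in> cw_verts (Relabel i j t)" "x \<notin> A" "(u, x) \<in> cw_arcs (Relabel i j t)"
  then show "(v, x) \<in> cw_arcs (Relabel i j t)" using cut(4)[OF uv] by simp
qed

text \<open>Descend into the expression. Only a union divides the vertices, into two sets: while
  more than \<open>2 * m\<close> marked vertices (those in \<open>B\<close>) are present, one side
  keeps more than \<open>m\<close>. The descent stops once at most \<open>2 * m\<close>
  remain.\<close>

lemma balanced_cw_cut:
  assumes "cw_wf t" "m < card (cw_verts t \<inter> B)" "0 < m"
  shows "\<exists>A f. cw_cut t A f \<and> m < card (A \<inter> B) \<and> card (A \<inter> B) \<le> 2 * m"
  using assms
proof (induction t)
  case (Vertex i v)
  \<comment> \<open>At most one marked vertex is present, so \<open>0 < m\<close> excludes this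
    case.\<close>
  have "card ({v} \<inter> B) \<le> card {v}" by (rule card_mono) auto
  with Vertex show ?case by simp
next
  case (Union s t)
  show ?case
  proof (cases "card (cw_verts (Union s t) \<inter> B) \<le> 2 * m")
    case True
    with Union.prems(2) show ?thesis
      by (intro exI[of _ "cw_verts (Union s t)"] exI[of _ "cw_lab (Union s t)"] conjI cw_cut_self)
  next
    case False
    have "card (cw_verts (Union s t) \<inter> B) \<le> card (cw_verts s \<inter> B) + card (cw_verts t \<inter> B)"
      by (simp add: Int_Un_distrib2 card_Un_le)
    with False have "m < card (cw_verts s \<inter> B) \<or> m < card (cw_verts t \<inter> B)" by linarith
    then show ?thesis
    proof
      assume "m < card (cw_verts s \<inter> B)"
      with Union.IH(1) Union.prems obtain A f where
        "cw_cut s A f" "m < card (A \<inter> B)" "card (A \<inter> B) \<le> 2 * m" by auto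
      moreover have "cw_cut (Union s t) A f"
        using Union.prems(1) by (intro cw_cut_Union1 \<open>cw_cut s A f\<close>) simp
      ultimately show ?thesis by (intro exI[of _ A] exI[of _ f] conjI)
    next
      assume "m < card (cw_verts t \<inter> B)"
      with Union.IH(2) Union.prems obtain A f where
        "cw_cut t A f" "m < card (A \<inter> B)" "card (A \<inter> B) \<le> 2 * m" by auto
      moreover have "cw_cut (Union s t) A f"
        using Union.prems(1) by (intro cw_cut_Union2 \<open>cw_cut t A f\<close>) simp
      ultimately show ?thesis by (intro exI[of _ A] exI[of _ f] conjI)
    qed
  qed
next
  case (Join i j t)
  then obtain A f where "cw_cut t A f" "m < card (A \<inter> B)" "card (A \<inter> B) \<le> 2 * m" by auto
  then show ?case using cw_cut_Join[of t A f i j] by (intro exI[of _ A] exI[of _ f] conjI)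
next
  case (Relabel i j t)
  then obtain A f where "cw_cut t A f" "m < card (A \<inter> B)" "card (A \<inter> B) \<le> 2 * m" by auto
  then show ?case using cw_cut_Relabel[of t A f i j] by (intro exI[of _ A] exI[of _ f] conjI)
qed

section \<open>Subdivided grids\<close>

definition grid_adj :: "nat \<times> nat \<Rightarrow> nat \<times> nat \<Rightarrow> bool" where
  "grid_adj p q \<longleftrightarrow>
     snd p = snd q \<and> (fst q = Suc (fst p) \<or> fst p = Suc (fst q)) \<or>
     fst p = fst q \<and> (snd q = Suc (snd p) \<or> snd p = Suc (snd q))"

text \<open>
  As an induced subgraph of the square lattice, \<open>streets n\<close> is the \<open>n\<close> by \<open>n\<close> grid with
  every edge replaced by a path of length \<open>n\<close> (and some pendant paths).
\<close>

definition streets :: "nat \<Rightarrow> (nat \<times> nat) set" where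
  "streets n = {p. fst p < n * n \<and> snd p < n * n \<and> (n dvd fst p \<or> n dvd snd p)}"

text \<open>The target is a bare set with a relation, so that it can be a set of lattice points or a
  graph.\<close>

definition embeds_via :: "('a \<Rightarrow> 'b) \<Rightarrow> 'a pair_pre_digraph \<Rightarrow> 'b set \<Rightarrow> ('b \<Rightarrow> 'b \<Rightarrow> bool) \<Rightarrow> bool" where
  "embeds_via f G V R \<longleftrightarrow> inj_on f (pverts G) \<and> f ` pverts G \<subseteq> V \<and>
     (\<forall>u \<in> pverts G. \<forall>v \<in> pverts G. (u, v) \<in> parcs G \<longleftrightarrow> R (f u) (f v))"

lemma finite_streets: "finite (streets n)"
  by (rule finite_subset[of _ "{..<n * n} \<times> {..<n * n}"]) (auto simp: streets_def)

text \<open>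
  Some nonzero residue \<open>\<rho>\<close> is avoided by a small set of points, which cuts every subdivided edge
  at the same place; the depth is the distance to the branch vertex on the same side of the cut.
  For a point of \<open>streets n\<close> one of the two summands vanishes.
\<close>

definition cut_dist :: "nat \<Rightarrow> nat \<Rightarrow> nat \<Rightarrow> nat" where
  "cut_dist n \<rho> x = (if x mod n < \<rho> then x mod n else n - x mod n)"

definition street_depth :: "nat \<Rightarrow> nat \<Rightarrow> nat \<times> nat \<Rightarrow> nat" where
  "street_depth n \<rho> p = cut_dist n \<rho> (fst p) + cut_dist n \<rho> (snd p)"

text \<open>Within a period the distance rises before \<open>\<rho>\<close> and falls after it.
  Steps onto or off \<open>\<rho>\<close> are excluded, and the wrap from residue
  \<open>n - 1\<close> to 0 continues the descent, from 1 to 0.\<close>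

lemma cut_dist_Suc:
  assumes "0 < \<rho>" "\<rho> < n" "x mod n \<noteq> \<rho>" "Suc x mod n \<noteq> \<rho>"
  shows "x mod n < \<rho> \<and> Suc x mod n < \<rho> \<and> cut_dist n \<rho> (Suc x) = Suc (cut_dist n \<rho> x) \<or>
         \<rho> < x mod n \<and> cut_dist n \<rho> x = Suc (cut_dist n \<rho> (Suc x))"
proof -
  obtain r where r: "x mod n = r" "r < n" using assms(2) by simp
  then show ?thesis using assms unfolding cut_dist_def mod_Suc r(1) by (auto split: if_splits)
qed

lemma street_depth_adj:
  assumes "0 < \<rho>" "\<rho> < n" "fst p mod n \<noteq> \<rho>" "snd p mod n \<noteq> \<rho>" "fst q mod n \<noteq> \<rho>" "snd q mod n \<noteq> \<rho>"
    and "grid_adj p q"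
  shows "street_depth n \<rho> p \<noteq> street_depth n \<rho> q"
proof -
  have "cut_dist n \<rho> x \<noteq> cut_dist n \<rho> y"
    if "y = Suc x \<or> x = Suc y" "x mod n \<noteq> \<rho>" "y mod n \<noteq> \<rho>" for x y
    using that cut_dist_Suc[OF assms(1,2), of x] cut_dist_Suc[OF assms(1,2), of y] by auto
  with assms show ?thesis by (auto simp: grid_adj_def street_depth_def)
qed

text \<open>The right-hand side does not mention \<open>q\<close>, so a neighbour of smaller depth
  is unique. A coordinate divisible by \<open>n\<close> contributes 0 and cannot decrease; only the
  other one can move, towards the branch vertex on its side of the cut.\<close>

lemma street_depth_parent:
  assumes "0 < \<rho>" "\<rho> < n" "p \<in> streets n"
    and "fst p mod n \<noteq> \<rho>" "snd p mod n \<noteq> \<rho>" "fst q mod n \<noteq> \<rho>" "snd q mod n \<noteq> \<rho>"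
    and "grid_adj p q" "street_depth n \<rho> q < street_depth n \<rho> p"
  shows "q = (if n dvd fst p then (fst p, if snd p mod n < \<rho> then snd p - 1 else Suc (snd p))
              else (if fst p mod n < \<rho> then fst p - 1 else Suc (fst p), snd p))"
proof -
  have parent: "y = (if x mod n < \<rho> then x - 1 else Suc x) \<and> \<not> n dvd x"
    if "y = Suc x \<or> x = Suc y" "x mod n \<noteq> \<rho>" "y mod n \<noteq> \<rho>" "cut_dist n \<rho> y < cut_dist n \<rho> x" for x y
  proof
    show "y = (if x mod n < \<rho> then x - 1 else Suc x)"
      using that cut_dist_Suc[OF assms(1,2), of x] cut_dist_Suc[OF assms(1,2), of y] by auto
    show "\<not> n dvd x" using that(4) assms(1) by (auto simp: cut_dist_def)
  qed
  from assms(8) consider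
    (horizontal) "snd q = snd p" "fst q = Suc (fst p) \<or> fst p = Suc (fst q)" |
    (vertical) "fst q = fst p" "snd q = Suc (snd p) \<or> snd p = Suc (snd q)"
    by (auto simp: grid_adj_def)
  then show ?thesis
  proof cases
    case horizontal
    with assms(9) parent[of "fst q" "fst p"] assms(4,6) show ?thesis
      by (auto simp: street_depth_def prod_eq_iff)
  next
    case vertical
    with assms(9) parent[of "snd q" "snd p"] assms(5,7) have
      "snd q = (if snd p mod n < \<rho> then snd p - 1 else Suc (snd p))" "\<not> n dvd snd p"
      by (auto simp: street_depth_def)
    with assms(3) vertical(1) show ?thesis by (simp add: streets_def prod_eq_iff)
  qed
qed

text \<open>So few vertices miss one of the \<open>n - 1\<close> nonzero residues. Cutting every
  subdivided edge there leaves a forest, with \<open>street_depth\<close> as depth.\<close>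

lemma clique_width_small_in_streets:
  fixes G :: "nat pair_pre_digraph"
  assumes "pair_graph G" "embeds_via f G (streets n) grid_adj" "card (pverts G) + 1 < n"
  shows "clique_width G \<le> 3"
proof (cases "pverts G = {}")
  case True
  then show ?thesis by (simp add: clique_width_def)
next
  case False
  \<comment> \<open>One coordinate of a street point is divisible by \<open>n\<close>, so this sum
    is the residue of the other. Each vertex thus occupies a single residue.\<close>
  define res where "res p = fst p mod n + snd p mod n" for p :: "nat \<times> nat"
  have g: "finite (pverts G)" "parcs G \<subseteq> pverts G \<times> pverts G" "sym (parcs G)"
    using assms(1) by (auto simp: pair_graph_iff)
  have "card ((res \<circ> f) ` pverts G) < card {1..<n}"
    using card_image_le[OF g(1), of "res \<circ> f"] assms(3) by simp
  then have "\<not> {1..<n} \<subseteq> (res \<circ> f) ` pverts G"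
    using g(1) by (meson card_mono finite_imageI not_le)
  then obtain \<rho> where "\<rho> \<in> {1..<n}" "\<rho> \<notin> (res \<circ> f) ` pverts G" by blast
  then have \<rho>: "0 < \<rho>" "\<rho> < n"
    and res: "\<And>v. v \<in> pverts G \<Longrightarrow> res (f v) \<noteq> \<rho>"
    by auto
  have in_streets: "f v \<in> streets n" if "v \<in> pverts G" for v
    using assms(2) that by (auto simp: embeds_via_def)
  have avoid: "fst (f v) mod n \<noteq> \<rho>" "snd (f v) mod n \<noteq> \<rho>" if "v \<in> pverts G" for v
    using in_streets[OF that] res[OF that] \<rho>(1) by (auto simp: streets_def res_def)
  have inj: "inj_on f (pverts G)" using assms(2) by (simp add: embeds_via_def)
  have verts: "u \<in> pverts G" "v \<in> pverts G" if "(u, v) \<in> parcs G" for u v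
    using that g(2) by auto
  have adj: "grid_adj (f u) (f v)" if "(u, v) \<in> parcs G" for u v
    using assms(2) that verts[OF that] by (auto simp: embeds_via_def)
  have "\<exists>t :: (nat, nat) cw_expr. cw_wf t \<and> cw_verts t = pverts G \<and> cw_arcs t = parcs G \<and>
      cw_labels t \<subseteq> {0, 1, 2} \<and> (\<forall>v \<in> pverts G. cw_lab t v =
        (if \<exists>u. (v, u) \<in> parcs G \<and> street_depth n \<rho> (f u) < street_depth n \<rho> (f v) then 0 else 1))"
  proof (rule forest_expr[OF g(1) False g(2,3)])
    fix u v assume uv: "(u, v) \<in> parcs G"
    then show "street_depth n \<rho> (f u) \<noteq> street_depth n \<rho> (f v)"
      by (intro street_depth_adj \<rho> avoid adj verts[OF uv])
  next
    fix u v w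
    assume *: "(u, v) \<in> parcs G" "(u, w) \<in> parcs G"
      "street_depth n \<rho> (f v) < street_depth n \<rho> (f u)" "street_depth n \<rho> (f w) < street_depth n \<rho> (f u)"
    have "f v = f w"
      using street_depth_parent[OF \<rho> in_streets[OF verts(1)[OF *(1)]] avoid avoid adj[OF *(1)] *(3)]
        street_depth_parent[OF \<rho> in_streets[OF verts(1)[OF *(2)]] avoid avoid adj[OF *(2)] *(4)]
        verts[OF *(1)] verts[OF *(2)] by simp
    then show "v = w" using inj verts[OF *(1)] verts[OF *(2)] by (meson inj_onD)
  qed
  then obtain t :: "(nat, nat) cw_expr" where
    "cw_wf t" "cw_verts t = pverts G" "cw_arcs t = parcs G" "cw_labels t \<subseteq> {0, 1, 2}" by blast
  then have "clique_width G \<le> card (cw_labels t)" "card (cw_labels t) \<le> card {0, 1, 2 :: nat}"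
    by (simp_all add: clique_width_le cw_graph_def card_mono del: card_insert_disjoint)
  then show ?thesis by simp
qed

section \<open>Subdivided grids have large clique-width\<close>

lemma ex_boundary_step:
  fixes Q :: "nat \<Rightarrow> bool"
  assumes "i < N" "j < N" "Q i" "\<not> Q j"
  shows "\<exists>l. Suc l < N \<and> Q l \<noteq> Q (Suc l)"
proof (rule ccontr)
  assume *: "\<not> ?thesis"
  have "Q l = Q 0" if "l < N" for l
    using that
  proof (induction l)
    case (Suc l)
    then have "Q l = Q (Suc l)" using * by blast
    with Suc show ?case by simp
  qed simp
  with assms show False by blast
qed

text \<open>
  Two distinct lines are not adjacent, so the boundary vertices chosen on different lines have
  different neighbourhoods across the cut and hence different labels.
\<close>

lemma card_mixed_lines_le:
  fixes line :: "nat \<Rightarrow> nat \<Rightarrow> nat \<times> nat" and lab :: "nat \<times> nat \<Rightarrow> 'l"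
  assumes in_S: "\<And>b i. b \<in> I \<Longrightarrow> i < N \<Longrightarrow> line b i \<in> S"
    and step: "\<And>b i. grid_adj (line b i) (line b (Suc i))"
    and far: "\<And>b c i j. b \<noteq> c \<Longrightarrow> \<not> grid_adj (line b i) (line c j)"
    and mixed: "\<And>b. b \<in> I \<Longrightarrow> (\<exists>i<N. line b i \<in> A) \<and> (\<exists>i<N. line b i \<notin> A)"
    and labels: "lab ` A \<subseteq> L" "finite L"
    and cut: "\<And>u v x. u \<in> A \<Longrightarrow> v \<in> A \<Longrightarrow> lab u = lab v \<Longrightarrow> x \<in> S - A \<Longrightarrow> grid_adj u x \<Longrightarrow> grid_adj v x"
  shows "card I \<le> card L"
proof -
  have "\<exists>i j. i < N \<and> j < N \<and> line b i \<in> A \<and> line b j \<notin> A \<and> grid_adj (line b i) (line b j)"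
    if "b \<in> I" for b
  proof -
    from mixed[OF that] obtain l where l: "Suc l < N" "(line b l \<in> A) \<noteq> (line b (Suc l) \<in> A)"
      using ex_boundary_step[of _ N _ "\<lambda>i. line b i \<in> A"] by blast
    \<comment> \<open>Either end of the step may be the one in \<open>A\<close>, so both
      orientations are needed.\<close>
    have "grid_adj (line b (Suc l)) (line b l)" using step[of b l] by (auto simp: grid_adj_def)
    with l step[of b l] Suc_lessD[OF l(1)] show ?thesis by blast
  qed
  then obtain i j where ij: "\<And>b. b \<in> I \<Longrightarrow> i b < N \<and> j b < N \<and> line b (i b) \<in> A \<and>
      line b (j b) \<notin> A \<and> grid_adj (line b (i b)) (line b (j b))"
    by metis
  have "inj_on (\<lambda>b. lab (line b (i b))) I"
  proof (rule inj_onI, rule ccontr)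
    fix b c
    assume bc: "b \<in> I" "c \<in> I" "lab (line b (i b)) = lab (line c (i c))" "b \<noteq> c"
    note b = ij[OF bc(1)] and c = ij[OF bc(2)]
    have "line b (j b) \<in> S - A" using in_S[OF bc(1), of "j b"] b by blast
    with b c have "grid_adj (line c (i c)) (line b (j b))"
      using cut[OF _ _ bc(3)] by blast
    with far[of c b] bc(4) show False by blast
  qed
  moreover have "(\<lambda>b. lab (line b (i b))) ` I \<subseteq> L" using ij labels(1) by blast
  ultimately show ?thesis using labels(2) card_inj_on_le by blast
qed

text \<open>\<open>A\<close> holds between one and two thirds of the \<open>9 * q * q\<close> branch
  vertices. If some row lies inside \<open>A\<close> and another outside, all columns are mixed.
  Otherwise the branch vertices in \<open>A\<close>, or those outside it, all lie on mixed rows;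
  there are at least \<open>3 * q * q\<close> of them, at most \<open>n\<close> per row.\<close>

lemma many_mixed_lines:
  fixes A :: "(nat \<times> nat) set"
  assumes A: "3 * q * q < card (A \<inter> (\<lambda>(a, b). (a * n, b * n)) ` ({..<n} \<times> {..<n}))"
      "card (A \<inter> (\<lambda>(a, b). (a * n, b * n)) ` ({..<n} \<times> {..<n})) \<le> 6 * q * q"
    and n: "n = 3 * q"
  defines "rows \<equiv> {b. b < n \<and> (\<exists>i<n * n. (i, b * n) \<in> A) \<and> (\<exists>i<n * n. (i, b * n) \<notin> A)}"
    and "cols \<equiv> {a. a < n \<and> (\<exists>i<n * n. (a * n, i) \<in> A) \<and> (\<exists>i<n * n. (a * n, i) \<notin> A)}"
  shows "q \<le> card rows \<or> q \<le> card cols"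
proof -
  let ?g = "\<lambda>(a, b). (a * n, b * n)"
  let ?B = "?g ` ({..<n} \<times> {..<n})"
  have q: "0 < q" using A by (cases q) auto
  with n have n0: "0 < n" by simp
  have inj: "inj_on ?g X" for X using n0 by (auto simp: inj_on_def)
  have small: "card (?B \<inter> C) \<le> card rows * n"
    if "\<And>a b. a < n \<Longrightarrow> b < n \<Longrightarrow> (a * n, b * n) \<in> C \<Longrightarrow> b \<in> rows" for C
  proof -
    have "finite rows" by (simp add: rows_def)
    have "?B \<inter> C \<subseteq> ?g ` ({..<n} \<times> rows)" using that by auto
    then have "card (?B \<inter> C) \<le> card (?g ` ({..<n} \<times> rows))"
      using \<open>finite rows\<close> by (intro card_mono) auto
    also have "\<dots> = card rows * n" by (simp add: card_image[OF inj] card_cartesian_product)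
    finally show ?thesis .
  qed
  have lt: "a * n < n * n" if "a < n" for a using that n0 by simp
  consider (both) b c where "b < n" "c < n" "\<forall>i<n * n. (i, b * n) \<in> A" "\<forall>i<n * n. (i, c * n) \<notin> A"
    | (no_full) "\<forall>b<n. \<exists>i<n * n. (i, b * n) \<notin> A"
    | (no_empty) "\<forall>b<n. \<exists>i<n * n. (i, b * n) \<in> A"
    by blast
  then show ?thesis
  proof cases
    case both
    \<comment> \<open>Every column crosses both the full row and the empty row.\<close>
    then have "cols = {..<n}" using lt unfolding cols_def by blast
    with n show ?thesis by simp
  next
    case no_full
    have "card (?B \<inter> A) \<le> card rows * n"
      using no_full lt unfolding rows_def by (intro small[unfolded rows_def]) blast
    then have "card (A \<inter> ?B) \<le> card rows * n" by (simp only: Int_commute)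
    moreover have "q * n = 3 * q * q" by (simp add: n)
    ultimately have "q * n < card rows * n" using A(1) by linarith
    then show ?thesis by simp
  next
    case no_empty
    have "card ?B = n * n" by (simp add: card_image[OF inj] card_cartesian_product)
    moreover have "card ?B = card (A \<inter> ?B) + card (?B \<inter> - A)"
      by (subst card_Un_disjoint[symmetric]) (auto intro: arg_cong[where f = card])
    moreover have "card (?B \<inter> - A) \<le> card rows * n"
      using no_empty lt unfolding rows_def by (intro small[unfolded rows_def]) blast
    ultimately have "n * n \<le> 6 * q * q + card rows * n" using A(2) by linarith
    moreover have "n * n = q * n + 6 * q * q" by (simp add: n)
    ultimately have "q * n \<le> card rows * n" by linarith
    then show ?thesis using n0 by simp
  qed
qed

section \<open>Lower bound for the clique-width of subdivided grids\<close>

text \<open>The pairing function moves lattice points to natural numbers, where the graph classes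
  live.\<close>

definition street_graph :: "nat \<Rightarrow> nat pair_pre_digraph" where
  "street_graph n = \<lparr>pverts = prod_encode ` streets n,
     parcs = {(u, v). u \<in> prod_encode ` streets n \<and> v \<in> prod_encode ` streets n \<and>
       grid_adj (prod_decode u) (prod_decode v)}\<rparr>"

lemma pair_graph_street_graph: "pair_graph (street_graph n)"
  unfolding pair_graph_iff
  by (auto simp: street_graph_def finite_streets sym_def irrefl_def grid_adj_def)

lemma embeds_via_street_graph: "embeds_via prod_decode (street_graph n) (streets n) grid_adj"
  by (auto simp: embeds_via_def street_graph_def inj_on_def)

text \<open>An optimal expression has a cut balanced on the branch vertices. It leaves
  \<open>q\<close> mixed rows or \<open>q\<close> mixed columns, and each of these needs its own
  label.\<close>

lemma clique_width_street_graph: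
  assumes "0 < q"
  shows "q \<le> clique_width (street_graph (3 * q))"
proof -
  define n where "n = 3 * q"
  have n: "1 < n" using assms by (simp add: n_def)
  define B where "B = (\<lambda>(a, b). (a * n, b * n)) ` ({..<n} \<times> {..<n})"
  have B: "B \<subseteq> streets n" using n by (auto simp: B_def streets_def)
  have cardB: "card B = n * n"
    unfolding B_def using n by (subst card_image) (auto simp: inj_on_def card_cartesian_product)
  then have "B \<noteq> {}" using n by auto
  with B have "pverts (street_graph n) \<noteq> {}" by (auto simp: street_graph_def)
  then obtain t :: "(nat, nat) cw_expr" where t:
    "cw_wf t" "cw_graph t = street_graph n" "card (cw_labels t) = clique_width (street_graph n)"
    using clique_width_attained[OF pair_graph_street_graph] by blast
  have verts: "cw_verts t = prod_encode ` streets n" and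
    arcs: "cw_arcs t = {(u, v). u \<in> prod_encode ` streets n \<and> v \<in> prod_encode ` streets n \<and>
       grid_adj (prod_decode u) (prod_decode v)}"
    using t(2) by (auto simp: cw_graph_def street_graph_def)
  have "cw_verts t \<inter> prod_encode ` B = prod_encode ` B" using verts B by auto
  then have "card (cw_verts t \<inter> prod_encode ` B) = 9 * q * q"
    by (simp add: card_image inj_prod_encode cardB n_def)
  then obtain A0 f where cut: "cw_cut t A0 f" and
    bal: "3 * q * q < card (A0 \<inter> prod_encode ` B)" "card (A0 \<inter> prod_encode ` B) \<le> 6 * q * q"
    using balanced_cw_cut[OF t(1), of "3 * q * q" "prod_encode ` B"] assms by auto
  \<comment> \<open>The cut is pulled back to lattice coordinates.\<close>
  define A where "A = prod_decode ` A0"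
  define lab where "lab = f \<circ> prod_encode"
  have A0: "A0 = prod_encode ` A" by (simp add: A_def image_image)
  then have "A0 \<inter> prod_encode ` B = prod_encode ` (A \<inter> B)"
    by (simp add: image_Int inj_prod_encode)
  then have card_A: "card (A0 \<inter> prod_encode ` B) = card (A \<inter> B)"
    by (simp add: card_image inj_prod_encode)
  have labels: "lab ` A \<subseteq> cw_labels t" using cut by (auto simp: cw_cut_def A0 lab_def)
  have A_sub: "A \<subseteq> streets n"
    using cut verts by (auto simp: cw_cut_def A0 inj_image_subset_iff[OF inj_prod_encode])
  have cut': "grid_adj v x"
    if "u \<in> A" "v \<in> A" "lab u = lab v" "x \<in> streets n - A" "grid_adj u x" for u v x
  proof -
    have "prod_encode x \<in> cw_verts t - A0" using that(4) verts by (auto simp: A0)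
    moreover have "prod_encode u \<in> A0" "prod_encode v \<in> A0" using that(1,2) by (auto simp: A0)
    ultimately have "(prod_encode u, prod_encode x) \<in> cw_arcs t \<longleftrightarrow> (prod_encode v, prod_encode x) \<in> cw_arcs t"
      using cut that(3) unfolding cw_cut_def lab_def comp_def by blast
    then show ?thesis using that A_sub by (auto simp: arcs)
  qed
  \<comment> \<open>Multiples of \<open>n > 1\<close> never differ by one, so distinct parallel
    lines are not adjacent.\<close>
  have far: "Suc (b * n) \<noteq> c * n \<and> b * n \<noteq> Suc (c * n)" for b c
    using n by (metis dvd_triv_right dvd_add_right_iff nat_dvd_1_iff_1 less_irrefl Suc_eq_plus1)
  have "q \<le> card {b. b < n \<and> (\<exists>i<n * n. (i, b * n) \<in> A) \<and> (\<exists>i<n * n. (i, b * n) \<notin> A)} \<or>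
        q \<le> card {a. a < n \<and> (\<exists>i<n * n. (a * n, i) \<in> A) \<and> (\<exists>i<n * n. (a * n, i) \<notin> A)}"
    (is "q \<le> card ?rows \<or> q \<le> card ?cols")
    by (rule many_mixed_lines[OF bal[unfolded card_A, unfolded B_def] n_def])
  moreover have "card ?rows \<le> card (cw_labels t)"
    by (rule card_mixed_lines_le[where line = "\<lambda>b i. (i, b * n)" and N = "n * n" and S = "streets n",
        OF _ _ _ _ labels finite_cw_labels cut'])
      (use n far in \<open>auto simp: streets_def grid_adj_def\<close>)
  moreover have "card ?cols \<le> card (cw_labels t)"
    by (rule card_mixed_lines_le[where line = "\<lambda>a i. (a * n, i)" and N = "n * n" and S = "streets n",
        OF _ _ _ _ labels finite_cw_labels cut'])
      (use n far in \<open>auto simp: streets_def grid_adj_def\<close>)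
  ultimately show ?thesis unfolding t(3) n_def[symmetric] by linarith
qed

section \<open>Hereditary classes defined by embeddings\<close>

text \<open>The induced subgraph relation up to isomorphism.\<close>

definition embeds :: "'a pair_pre_digraph \<Rightarrow> 'b pair_pre_digraph \<Rightarrow> bool" where
  "embeds H G \<longleftrightarrow> (\<exists>f. embeds_via f H (pverts G) (\<lambda>u v. (u, v) \<in> parcs G))"

lemma embeds_refl: "embeds G G"
  unfolding embeds_def embeds_via_def by (rule exI[of _ id]) auto

lemma embeds_via_comp:
  assumes "embeds_via g H (pverts G) (\<lambda>u v. (u, v) \<in> parcs G)" "embeds_via f G V R"
  shows "embeds_via (f \<circ> g) H V R"
  using assms unfolding embeds_via_def
  by (auto simp: image_subset_iff intro: comp_inj_on inj_on_subset)

lemma embeds_trans: "embeds F H \<Longrightarrow> embeds H G \<Longrightarrow> embeds F G"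
  unfolding embeds_def using embeds_via_comp by blast

lemma iso_embeds:
  assumes "pair_graph G" "digraph_iso (with_proj G) (with_proj H)"
  shows "pair_graph H" "embeds H G"
proof -
  from assms(2) obtain h where
    h: "pre_digraph.digraph_isomorphism (with_proj G) h" "with_proj H = app_iso h (with_proj G)"
    by (auto simp: digraph_iso_def)
  define k where "k = iso_verts h"
  have inj: "inj_on k (pverts G)" and ends: "\<And>a. a \<in> parcs G \<Longrightarrow>
      k (fst a) = iso_tail h (iso_arcs h a) \<and> k (snd a) = iso_head h (iso_arcs h a)"
    using h(1) by (auto simp: pre_digraph.digraph_isomorphism_def k_def)
  have HV: "pverts H = k ` pverts G" and HA: "parcs H = iso_arcs h ` parcs G"
    and th: "iso_tail h = fst" "iso_head h = snd"
    using arg_cong[OF h(2), of verts] arg_cong[OF h(2), of arcs]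
      arg_cong[OF h(2), of tail] arg_cong[OF h(2), of head] by (auto simp: k_def)
  \<comment> \<open>Tail and head in \<open>H\<close> are the projections, so the image of an arc is
    determined by the images of its ends.\<close>
  have "iso_arcs h a = map_prod k k a" if "a \<in> parcs G" for a
    using ends[OF that] th by (simp add: prod_eq_iff)
  then have HA': "parcs H = map_prod k k ` parcs G" using HA by simp
  have g: "finite (pverts G)" "parcs G \<subseteq> pverts G \<times> pverts G" "sym (parcs G)" "irrefl (parcs G)"
    using assms(1) by (auto simp: pair_graph_iff)
  have arc_iff: "(k u, k v) \<in> parcs H \<longleftrightarrow> (u, v) \<in> parcs G" if "u \<in> pverts G" "v \<in> pverts G" for u v
  proof
    assume "(k u, k v) \<in> parcs H"
    then obtain a b where ab: "(a, b) \<in> parcs G" "k u = k a" "k v = k b" by (auto simp: HA')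
    then have "a \<in> pverts G" "b \<in> pverts G" using g(2) by auto
    with ab that inj have "u = a" "v = b" by (meson inj_onD)+
    with ab show "(u, v) \<in> parcs G" by simp
  qed (force simp: HA')
  show "pair_graph H"
    unfolding pair_graph_iff
  proof (intro conjI)
    show "finite (pverts H)" using g(1) HV by simp
    show "parcs H \<subseteq> pverts H \<times> pverts H" using g(2) HV HA' by auto
    show "sym (parcs H)"
      using g(3) unfolding HA' sym_def by force
    show "irrefl (parcs H)"
      using g(2,4) inj unfolding HA' irrefl_def by (auto dest: inj_onD)
  qed
  show "embeds H G"
    unfolding embeds_def embeds_via_def HV
    using inj arc_iff by (intro exI[of _ "the_inv_into (pverts G) k"])
      (auto simp: the_inv_into_f_f intro!: inj_on_the_inv_into)
qed

lemma induced_subgraph_embeds: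
  assumes "pair_graph G" "induced_subgraph (with_proj H) (with_proj G)"
  shows "pair_graph H" "embeds H G"
proof -
  have H: "pverts H \<subseteq> pverts G" "parcs H = {e \<in> parcs G. fst e \<in> pverts H \<and> snd e \<in> pverts H}"
    using assms(2) by (auto simp: induced_subgraph_def subgraph_def)
  have g: "finite (pverts G)" "parcs G \<subseteq> pverts G \<times> pverts G" "sym (parcs G)" "irrefl (parcs G)"
    using assms(1) by (auto simp: pair_graph_iff)
  show "pair_graph H"
    unfolding pair_graph_iff using H g finite_subset by (auto simp: sym_def irrefl_def)
  show "embeds H G"
    unfolding embeds_def embeds_via_def using H by (intro exI[of _ id]) auto
qed

text \<open>Isomorphic copies and induced subgraphs both embed in the original graph, so closure
  under \<open>embeds\<close> covers both conditions.\<close>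

lemma hereditaryI:
  assumes "\<And>G. G \<in> X \<Longrightarrow> pair_graph G"
    and "\<And>G H. G \<in> X \<Longrightarrow> pair_graph H \<Longrightarrow> embeds H G \<Longrightarrow> H \<in> X"
  shows "hereditary X"
  unfolding hereditary_def graph_class_def
proof (intro conjI ballI allI impI)
  fix G assume G: "G \<in> X"
  note graph = assms(1)[OF G]
  show "pair_graph G" by (fact graph)
  show "H \<in> X" if "digraph_iso (with_proj G) (with_proj H)" for H
    using assms(2)[OF G] iso_embeds[OF graph that] by blast
  show "H \<in> X" if "induced_subgraph (with_proj H) (with_proj G)" for H
    using assms(2)[OF G] induced_subgraph_embeds[OF graph that] by blast
qed

text \<open>By transitivity, a copy of \<open>H\<close> in an isomorphic copy or induced subgraph of
  \<open>G\<close> would already give one in \<open>G\<close>.\<close>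

lemma hereditary_avoiding:
  assumes "hereditary Y"
  shows "hereditary {G \<in> Y. \<not> embeds H G}"
proof -
  have Y: "pair_graph G" if "G \<in> Y" for G
    using assms that unfolding hereditary_def graph_class_def by blast
  show ?thesis
    unfolding hereditary_def graph_class_def
  proof (intro conjI ballI allI impI)
    fix G assume "G \<in> {G \<in> Y. \<not> embeds H G}"
    then have G: "G \<in> Y" "\<not> embeds H G" by auto
    note graph = Y[OF G(1)]
    show "pair_graph G" by (fact graph)
    show "F \<in> {G \<in> Y. \<not> embeds H G}" if iso: "digraph_iso (with_proj G) (with_proj F)" for F
    proof -
      have "F \<in> Y" using assms G(1) iso unfolding hereditary_def graph_class_def by blast
      moreover have "\<not> embeds H F" using G(2) embeds_trans[OF _ iso_embeds(2)[OF graph iso]] by (rule contrapos_nn)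
      ultimately show ?thesis by simp
    qed
    show "F \<in> {G \<in> Y. \<not> embeds H G}" if ind: "induced_subgraph (with_proj F) (with_proj G)" for F
    proof -
      have "F \<in> Y" using assms G(1) ind unfolding hereditary_def by blast
      moreover have "\<not> embeds H F"
        using G(2) embeds_trans[OF _ induced_subgraph_embeds(2)[OF graph ind]] by (rule contrapos_nn)
      ultimately show ?thesis by simp
    qed
  qed
qed

section \<open>The class without minimal subclasses\<close>

definition street_class :: "nat pair_pre_digraph set" where
  "street_class = {G. pair_graph G \<and> (\<exists>n f. embeds_via f G (streets n) grid_adj)}"

lemma hereditary_street_class: "hereditary street_class"
  by (rule hereditaryI) (auto simp: street_class_def embeds_def dest: embeds_via_comp)

lemma unbounded_clique_width_street_class: "unbounded_clique_width street_class"
  unfolding unbounded_clique_width_def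
proof
  assume "\<exists>k. \<forall>G \<in> street_class. clique_width G \<le> k"
  then obtain k where k: "\<forall>G \<in> street_class. clique_width G \<le> k" by blast
  have "street_graph (3 * Suc k) \<in> street_class"
    using pair_graph_street_graph embeds_via_street_graph by (auto simp: street_class_def)
  with k clique_width_street_graph[of "Suc k"] show False by fastforce
qed

text \<open>With \<open>clique_width_le_card\<close>, this makes large clique-width force large
  \<open>n\<close>.\<close>

lemma card_le_streets:
  assumes "embeds_via f G (streets n) grid_adj"
  shows "card (pverts G) \<le> n * n * (n * n)"
proof -
  have "streets n \<subseteq> {..<n * n} \<times> {..<n * n}" by (auto simp: streets_def)
  with assms have "card (pverts G) \<le> card ({..<n * n} \<times> {..<n * n})"
    by (intro card_inj_on_le[of f]) (auto simp: embeds_via_def)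
  then show ?thesis by (simp add: card_cartesian_product)
qed

theorem theorem3:
  shows "\<exists>X. hereditary X \<and> unbounded_clique_width X \<and>
           \<not> (\<exists>Y. Y \<subseteq> X \<and> minimal_unbounded_clique_width Y)"
proof (intro exI[of _ street_class] conjI notI hereditary_street_class
    unbounded_clique_width_street_class)
  assume "\<exists>Y. Y \<subseteq> street_class \<and> minimal_unbounded_clique_width Y"
  then obtain Y where Y: "Y \<subseteq> street_class" "hereditary Y" "unbounded_clique_width Y"
    and minimal: "\<not> (\<exists>Z. Z \<subset> Y \<and> hereditary Z \<and> unbounded_clique_width Z)"
    by (auto simp: minimal_unbounded_clique_width_def)
  from Y(3) obtain H where H: "H \<in> Y" "3 < clique_width H"
    by (auto simp: unbounded_clique_width_def not_le)
  have "unbounded_clique_width {G \<in> Y. \<not> embeds H G}"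
    unfolding unbounded_clique_width_def
  proof
    assume "\<exists>k. \<forall>G \<in> {G \<in> Y. \<not> embeds H G}. clique_width G \<le> k"
    then obtain k where k: "\<forall>G \<in> {G \<in> Y. \<not> embeds H G}. clique_width G \<le> k" by blast
    define N where "N = card (pverts H) + 1"
    \<comment> \<open>Exceeding \<open>k\<close> forces \<open>G\<close> to contain
      \<open>H\<close>; exceeding the other bound, the number of lattice points available for
      \<open>n = N\<close>, forces \<open>N < n\<close>, so that \<open>H\<close> is small relative
      to \<open>n\<close>.\<close>
    from Y(3) obtain G where G: "G \<in> Y" "max k (N * N * (N * N)) < clique_width G"
      unfolding unbounded_clique_width_def by (metis not_le)
    with Y(1) obtain n f where Gn: "pair_graph G" "embeds_via f G (streets n) grid_adj"
      by (auto simp: street_class_def)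
    have "N < n"
    proof (rule ccontr)
      assume "\<not> N < n"
      then have "n * n * (n * n) \<le> N * N * (N * N)" by (intro mult_le_mono) auto
      with card_le_streets[OF Gn(2)] clique_width_le_card[OF Gn(1)] G(2) show False by linarith
    qed
    have "embeds H G" using k G by force
    then obtain g where "embeds_via g H (pverts G) (\<lambda>u v. (u, v) \<in> parcs G)"
      by (auto simp: embeds_def)
    from embeds_via_comp[OF this Gn(2)] have "embeds_via (f \<circ> g) H (streets n) grid_adj" .
    moreover have "pair_graph H" using H(1) Y(1) by (auto simp: street_class_def)
    ultimately have "clique_width H \<le> 3"
      using \<open>N < n\<close> by (intro clique_width_small_in_streets) (auto simp: N_def)
    with H(2) show False by simp
  qed
  \<comment> \<open>The subclass is proper because \<open>H\<close> embeds in itself.\<close>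
  moreover have "{G \<in> Y. \<not> embeds H G} \<subset> Y" using H(1) embeds_refl by blast
  ultimately show False using minimal hereditary_avoiding[OF Y(2)] by blast
qed

end
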